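(* Let $\alpha\in(0,2)$ and $1\le p<\infty$. Then there are positive constants $c_1,c_2$ (independent of $x_0,t_0,r_0$) such that for all $(x_0,r_0)\in\mathbb{R}^{n+1}_+$ and all $t_0\ge0$, $$c_1\,r_0^n\le C^{\alpha,p}_{\mathbb{R}^{n+1}_+}\big(B_{r_0}(x_0,t_0)\big)\le c_2\,(t_0+r_0)^{pn}\,r_0^{n(1-p)}.$$ In particular, if $t_0\lesssim r_0$ (i.e. $t_0\le c\,r_0$ for a fixed constant $c>0$), then $$r_0^n\lesssim C^{\alpha,p}_{\mathbb{R}^{n+1}_+}\big(B_{r_0}(x_0,t_0)\big)\lesssim r_0^n,$$ with implicit constants independent of $x_0,t_0,r_0$ (but possibly depending on $c$).
   Context: $\mathbb{R}^{n+1}_+:=\mathbb{R}^n\times(0,\infty)$, $n\ge1$. For $\alpha\in(0,2)$, $p^\alpha_t(x)=c(n,\alpha)\,t^\alpha(|x|^2+t^2)^{-(n+\alpha)/2}$ with $c(n,\alpha)=\frac{\Gamma((n+\alpha)/2)}{\pi^{n/2}\Gamma(\alpha/2)}$, and $P_\alpha f(x,t)=\int_{\mathbb{R}^n}p^\alpha_t(x-y)f(y)\,dy$ is the Caffarelli-Silvestre extension. The $L^p$-capacity is $C^{\alpha,p}_{\mathbb{R}^{n+1}_+}(E):=\inf\{\|f\|^p_{L^p(\mathbb{R}^n)}:\ f\ge0,\ P_\alpha f(x,t)\ge1\text{ for all }(x,t)\in E\}$ for $E\subset\mathbb{R}^{n+1}_+$. For $t_0\ge0$, $x_0\in\mathbb{R}^n$,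 $r_0>0$: $B_{r_0}(x_0,t_0)=\{(x,t)\in\mathbb{R}^{n+1}_+:\ |x-x_0|<r_0/2,\ r_0<t-t_0<2r_0\}$. *)

theory Defs
  imports "HOL-Analysis.Analysis"
begin

definition upper_half_space :: "((real^'n) \<times> real) set" where
  "upper_half_space = {(x, t). 0 < t}"

definition cs_const :: "'n itself \<Rightarrow> real \<Rightarrow> real" where
  "cs_const _ \<alpha> =
     Gamma ((real CARD('n) + \<alpha>) / 2) / (pi powr (real CARD('n) / 2) * Gamma (\<alpha> / 2))"

definition cs_kernel :: "real \<Rightarrow> real \<Rightarrow> real^'n \<Rightarrow> real" where
  "cs_kernel \<alpha> t x =
     cs_const TYPE('n) \<alpha> * t powr \<alpha> *
       ((norm x)\<^sup>2 + t\<^sup>2) powr (- ((real CARD('n) + \<alpha>) / 2))"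

(* The Bochner integral is 0 for a non-integrable integrand.  This does not matter below: the
   extension is only used for f in L^p with p >= 1, where the integrand is integrable for t > 0
   because the kernel then lies in every L^q. *)
definition cs_extension :: "real \<Rightarrow> (real^'n \<Rightarrow> real) \<Rightarrow> real^'n \<Rightarrow> real \<Rightarrow> real" where
  "cs_extension \<alpha> f x t = (LINT y|lebesgue. cs_kernel \<alpha> t (x - y) * f y)"

definition Lp_space :: "real \<Rightarrow> (real^'n \<Rightarrow> real) set" where
  "Lp_space p =
     {f \<in> borel_measurable lebesgue. integrable lebesgue (\<lambda>x. \<bar>f x\<bar> powr p)}"

definition Lp_norm :: "real \<Rightarrow> (real^'n \<Rightarrow> real) \<Rightarrow> real" where
  "Lp_norm p f = (LINT x|lebesgue. \<bar>f x\<bar> powr p) powr (1 / p)"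

(* Functions outside L^p would contribute the value infinity to the infimum, so restricting to
   L^p changes nothing; if no admissible f exists, the infimum in ennreal is infinity. *)
definition Lp_capacity :: "real \<Rightarrow> real \<Rightarrow> ((real^'n) \<times> real) set \<Rightarrow> ennreal" where
  "Lp_capacity \<alpha> p E =
     (INF f \<in> {f \<in> Lp_space p. (\<forall>x. 0 \<le> f x) \<and>
                 (\<forall>(x, t) \<in> E. 1 \<le> cs_extension \<alpha> f x t)}.
        ennreal (Lp_norm p f powr p))"

definition cs_ball :: "real \<Rightarrow> real^'n \<Rightarrow> real \<Rightarrow> ((real^'n) \<times> real) set" where
  "cs_ball r0 x0 t0 =
     {(x, t) \<in> upper_half_space. norm (x - x0) < r0 / 2 \<and> r0 < t - t0 \<and> t - t0 < 2 * r0}"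

end

(* Write N = CARD('n). The kernel is at most a multiple of t^(-N) and, by a dyadic decomposition
   of space, its mass is bounded by a constant K independent of t. If the extension of f >= 0 is at
   least 1 at a single point (x, t), inserting f <= e + e^(1-p) f^p with e = 1 / (2 K) into the
   extension yields 1/2 <= C t^(-N) ||f||_p^p; the midpoint of the set has t >= r0, which gives
   the lower bound.
   For the upper bound take a multiple of the indicator of the ball of radius r0 around x0: on the
   set its extension is comparable to that multiple of (r0 / (t0 + r0))^N. *)
theory Submission
  imports Defs
begin

section \<open>Positivity and pointwise bounds of the kernel\<close>

lemma cs_const_pos:
  assumes "0 < \<alpha>"
  shows "0 < cs_const TYPE('n::finite) \<alpha>"
  using assms unfolding cs_const_def
  by (intro divide_pos_pos mult_pos_pos Gamma_real_pos) auto

lemma cs_kernel_nonneg: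
  assumes "0 < \<alpha>"
  shows "0 \<le> cs_kernel \<alpha> t (x :: real^'n)"
  using cs_const_pos[OF assms, where 'n='n] by (simp add: cs_kernel_def)

lemma cs_kernel_measurable [measurable]:
  "(\<lambda>y. cs_kernel \<alpha> t (x - y :: real^'n)) \<in> borel_measurable lebesgue"
  by (rule measurable_completion) (simp add: cs_kernel_def)

lemma power2_powr_minus_half:
  fixes R s :: real
  assumes "0 < R"
  shows "(R\<^sup>2) powr (- (s / 2)) = R powr (- s)"
  using assms by (simp add: powr_powr flip: powr_numeral)

text \<open>The kernel contains a negative power of |x|^2 + t^2, so a lower bound \<open>R\<close>
  for the length of (x, t) bounds it from above. The choice \<open>R = t\<close> gives the global
  bound, \<open>R = t * 2 ^ j\<close> the decay at distance \<open>t * 2 ^ j\<close>.\<close>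

lemma cs_kernel_le_of_le:
  fixes x :: "real^'n"
  assumes "0 < \<alpha>" "0 < R" "R\<^sup>2 \<le> (norm x)\<^sup>2 + t\<^sup>2"
  shows "cs_kernel \<alpha> t x \<le>
    cs_const TYPE('n) \<alpha> * t powr \<alpha> * R powr (- (real CARD('n) + \<alpha>))"
proof -
  let ?s = "real CARD('n) + \<alpha>"
  have "((norm x)\<^sup>2 + t\<^sup>2) powr (- (?s / 2)) \<le> (R\<^sup>2) powr (- (?s / 2))"
    using assms by (intro powr_mono2') auto
  also have "\<dots> = R powr (- ?s)"
    using assms by (simp add: power2_powr_minus_half)
  finally show ?thesis
    using cs_const_pos[OF assms(1), where 'n='n] unfolding cs_kernel_def
    by (intro mult_left_mono) auto
qed

lemma cs_kernel_ge_of_le: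
  fixes x :: "real^'n"
  assumes "0 < \<alpha>" "0 < R" "0 < t" "(norm x)\<^sup>2 + t\<^sup>2 \<le> R\<^sup>2"
  shows "cs_const TYPE('n) \<alpha> * t powr \<alpha> * R powr (- (real CARD('n) + \<alpha>))
    \<le> cs_kernel \<alpha> t x"
proof -
  let ?s = "real CARD('n) + \<alpha>"
  have "R powr (- ?s) = (R\<^sup>2) powr (- (?s / 2))"
    using assms by (simp add: power2_powr_minus_half)
  also have "\<dots> \<le> ((norm x)\<^sup>2 + t\<^sup>2) powr (- (?s / 2))"
    using assms by (intro powr_mono2') (auto intro: add_nonneg_pos)
  finally show ?thesis
    using cs_const_pos[OF assms(1), where 'n='n] unfolding cs_kernel_def
    by (intro mult_left_mono) auto
qed

lemma cs_kernel_le: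
  fixes x :: "real^'n"
  assumes "0 < \<alpha>" "0 < t"
  shows "cs_kernel \<alpha> t x \<le> cs_const TYPE('n) \<alpha> * t powr (- real CARD('n))"
proof -
  have "cs_kernel \<alpha> t x \<le>
      cs_const TYPE('n) \<alpha> * t powr \<alpha> * t powr (- (real CARD('n) + \<alpha>))"
    using assms by (intro cs_kernel_le_of_le) auto
  then show ?thesis
    by (simp add: mult.assoc flip: powr_add)
qed

text \<open>If k is the first dyadic scale with \<open>norm x < t * 2 ^ k\<close>, then x lies
  outside the ball of the previous scale, where the kernel has already decayed geometrically. The
  bound has product form so that it can serve as one term of a series over k.\<close>

lemma cs_kernel_le_dyadic:
  fixes x :: "real^'n"
  assumes "0 < \<alpha>" "0 < t"
  shows "\<exists>k. norm x < t * 2 ^ k \<and> cs_kernel \<alpha> t x \<le>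
    cs_const TYPE('n) \<alpha> * t powr (- real CARD('n)) * 2 powr (real CARD('n) + \<alpha>) *
      (2 powr (- (real CARD('n) + \<alpha>))) ^ k"
proof -
  let ?N = "real CARD('n)" and ?c = "cs_const TYPE('n) \<alpha>"
  have c: "0 < ?c" using assms cs_const_pos by blast
  obtain m :: nat where m: "norm x / t < 2 ^ m"
    using real_arch_pow[of 2 "norm x / t"] by auto
  define k where "k = (LEAST k. norm x < t * 2 ^ k)"
  have "norm x < t * 2 ^ m" using m assms by (simp add: field_simps)
  then have k: "norm x < t * 2 ^ k" unfolding k_def by (rule LeastI)
  have "cs_kernel \<alpha> t x \<le> ?c * t powr (- ?N) * 2 powr (?N + \<alpha>) * (2 powr (- (?N + \<alpha>))) ^ k"
  proof (cases k)
    case 0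
    \<comment> \<open>No previous scale exists here, and the global bound is enough: the factor
      \<open>2 powr (?N + \<alpha>)\<close> is at least 1.\<close>
    have "?c * t powr (- ?N) * 1 \<le> ?c * t powr (- ?N) * 2 powr (?N + \<alpha>)"
      using c assms by (intro mult_left_mono ge_one_powr_ge_zero) auto
    then show ?thesis using cs_kernel_le[OF assms, of x] 0 by simp
  next
    case (Suc j)
    have "\<not> norm x < t * 2 ^ j"
      using not_less_Least[of j "\<lambda>k. norm x < t * 2 ^ k"] Suc by (simp add: k_def)
    then have "(t * 2 ^ j)\<^sup>2 \<le> (norm x)\<^sup>2 + t\<^sup>2"
      using assms by (smt (verit) power_mono zero_le_power2 mult_nonneg_nonneg zero_le_power)
    then have "cs_kernel \<alpha> t x \<le> ?c * t powr \<alpha> * (t * 2 ^ j) powr (- (?N + \<alpha>))"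
      using assms by (intro cs_kernel_le_of_le) auto
    also have "(t * 2 ^ j) powr (- (?N + \<alpha>)) =
        t powr (- (?N + \<alpha>)) * (2 powr (- (?N + \<alpha>))) ^ j"
      using assms by (simp add: powr_mult powr_powr mult.commute flip: powr_realpow)
    also have "?c * t powr \<alpha> * (t powr (- (?N + \<alpha>)) * (2 powr (- (?N + \<alpha>))) ^ j) =
        ?c * (t powr \<alpha> * t powr (- (?N + \<alpha>))) * (2 powr (- (?N + \<alpha>))) ^ j"
      by simp
    also have "t powr \<alpha> * t powr (- (?N + \<alpha>)) = t powr (- ?N)"
      by (simp flip: powr_add)
    \<comment> \<open>The decay comes from scale j = k - 1; rewriting it in terms of k costs the
      factor \<open>2 powr (?N + \<alpha>)\<close>.\<close>
    also have "(2 powr (- (?N + \<alpha>))) ^ j = 2 powr (?N + \<alpha>) * (2 powr (- (?N + \<alpha>))) ^ k"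
      by (simp add: Suc mult.assoc[symmetric] flip: powr_add)
    finally show ?thesis by (simp add: mult.assoc)
  qed
  with k show ?thesis by blast
qed

section \<open>Uniform bound for the mass of the kernel\<close>

text \<open>The ball of radius \<open>t * 2 ^ k\<close> has volume proportional to t^N 2^(kN). Here
  t^N cancels the t^(-N) of the pointwise bound, and 2^(kN) reduces the decay 2^(-k(N + \<alpha>))
  to a geometric series of ratio 2^(-\<alpha>) < 1. The exact mass is 1, but any bound independent
  of t and x serves the purpose.\<close>

lemma cs_kernel_mass_bounded:
  assumes "0 < \<alpha>"
  obtains K where "0 < K"
    "\<And>t (x :: real^'n). 0 < t \<Longrightarrow> integrable lebesgue (\<lambda>y. cs_kernel \<alpha> t (x - y))"
    "\<And>t (x :: real^'n). 0 < t \<Longrightarrow> (LINT y|lebesgue. cs_kernel \<alpha> t (x - y)) \<le> K"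
proof -
  let ?N = "real CARD('n)" and ?c = "cs_const TYPE('n) \<alpha>" and ?V = "unit_ball_vol CARD('n)"
  define q where "q = 2 powr (- (?N + \<alpha>))"
  define A where "A = ?c * 2 powr (?N + \<alpha>) * ?V"
  define K where "K = A * (1 / (1 - 2 powr (- \<alpha>)))"
  have c: "0 < ?c" using assms cs_const_pos by blast
  have V: "0 < ?V" by simp
  have A: "0 < A" unfolding A_def using c V by simp
  have r: "2 powr (- \<alpha>) < (1 :: real)" using powr_less_mono[of "- \<alpha>" 0 2] assms by simp
  have K: "0 < K" unfolding K_def using A r by simp
  \<comment> \<open>The estimate is made for the nonnegative integral, which presupposes no
    integrability; finiteness then yields integrability.\<close>
  have nn: "(\<integral>\<^sup>+ y. ennreal (cs_kernel \<alpha> t (x - y)) \<partial>lebesgue) \<le> ennreal K"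
    if t: "0 < t" for t and x :: "real^'n"
  proof -
    define a where "a k = ?c * t powr (- ?N) * 2 powr (?N + \<alpha>) * q ^ k" for k
    have a: "0 \<le> a k" for k using c by (simp add: a_def q_def)
    have term_le: "g k \<le> suminf g" for g :: "nat \<Rightarrow> ennreal" and k
      using sum_le_suminf[OF summableI, of "{k}" g] by simp
    \<comment> \<open>Whole balls are summed instead of disjoint shells: a single term dominates the
      kernel at y, and the overlaps only enlarge the sum.\<close>
    have "ennreal (cs_kernel \<alpha> t (x - y)) \<le>
        (\<Sum>k. ennreal (a k) * indicator (ball x (t * 2 ^ k)) y)" for y
    proof -
      obtain k where k: "norm (x - y) < t * 2 ^ k" "cs_kernel \<alpha> t (x - y) \<le> a k"
        using cs_kernel_le_dyadic[OF assms t, of "x - y"] unfolding a_def q_def by blast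
      have "ennreal (cs_kernel \<alpha> t (x - y)) \<le> ennreal (a k) * indicator (ball x (t * 2 ^ k)) y"
        using k by (simp add: dist_norm ennreal_leI)
      also have "\<dots> \<le> (\<Sum>k. ennreal (a k) * indicator (ball x (t * 2 ^ k)) y)"
        by (rule term_le[of "\<lambda>k. ennreal (a k) * indicator (ball x (t * 2 ^ k)) y"])
      finally show ?thesis .
    qed
    then have "(\<integral>\<^sup>+ y. ennreal (cs_kernel \<alpha> t (x - y)) \<partial>lebesgue) \<le>
        (\<integral>\<^sup>+ y. (\<Sum>k. ennreal (a k) * indicator (ball x (t * 2 ^ k)) y) \<partial>lebesgue)"
      by (intro nn_integral_mono)
    also have "\<dots> = (\<Sum>k. \<integral>\<^sup>+ y. ennreal (a k) * indicator (ball x (t * 2 ^ k)) y \<partial>lebesgue)"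
      by (intro nn_integral_suminf borel_measurable_times_ennreal borel_measurable_const
        borel_measurable_indicator fmeasurableD[OF lmeasurable_ball])
    also have "\<dots> = (\<Sum>k. ennreal (a k) * ennreal (?V * (t * 2 ^ k) ^ CARD('n)))"
      using t by (simp add: nn_integral_cmult_indicator fmeasurableD[OF lmeasurable_ball] emeasure_ball)
    also have "\<dots> = (\<Sum>k. ennreal (A * (2 powr (- \<alpha>)) ^ k))"
    proof (intro suminf_cong)
      fix k
      have 1: "t powr (- ?N) * t ^ CARD('n) = 1"
        using t by (simp add: powr_minus powr_realpow)
      have 2: "q ^ k * (2 ^ k) ^ CARD('n) = (2 powr (- \<alpha>)) ^ k"
        unfolding q_def
        by (simp add: powr_powr flip: powr_realpow powr_add) (simp add: algebra_simps)
      have "a k * (?V * (t * 2 ^ k) ^ CARD('n)) =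
          A * (t powr (- ?N) * t ^ CARD('n)) * (q ^ k * (2 ^ k) ^ CARD('n))"
        by (simp add: a_def A_def power_mult_distrib)
      then have "a k * (?V * (t * 2 ^ k) ^ CARD('n)) = A * (2 powr (- \<alpha>)) ^ k"
        unfolding 1 2 by simp
      then show "ennreal (a k) * ennreal (?V * (t * 2 ^ k) ^ CARD('n)) =
          ennreal (A * (2 powr (- \<alpha>)) ^ k)"
        using a by (simp flip: ennreal_mult')
    qed
    also have "\<dots> = ennreal K"
      using A r unfolding K_def
      by (intro suminf_ennreal_eq sums_mult geometric_sums) auto
    finally show ?thesis .
  qed
  show ?thesis
  proof
    show "0 < K" by fact
    fix t :: real and x :: "real^'n" assume t: "0 < t"
    show "integrable lebesgue (\<lambda>y. cs_kernel \<alpha> t (x - y))"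
      using nn[OF t, of x] cs_kernel_nonneg[OF assms]
      by (intro integrableI_nonneg) (auto intro: le_less_trans)
    show "(LINT y|lebesgue. cs_kernel \<alpha> t (x - y)) \<le> K"
      using nn[OF t, of x] K by (intro integral_real_bounded) auto
  qed
qed

section \<open>Lower bound for the capacity\<close>

lemma Lp_norm_powr:
  fixes f :: "real^'n \<Rightarrow> real"
  assumes "0 < p"
  shows "Lp_norm p f powr p = (LINT x|lebesgue. \<bar>f x\<bar> powr p)"
  using assms by (simp add: Lp_norm_def powr_powr)

text \<open>Above the threshold \<epsilon>, u = u^(1-p) u^p and u^(1-p) \<le> \<epsilon>^(1-p)
  because 1 - p \<le> 0. This splitting takes the place of Hoelder's inequality and treats p = 1
  like every other exponent.\<close>

lemma le_add_powr:
  fixes u \<epsilon> p :: real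
  assumes "0 \<le> u" "0 < \<epsilon>" "1 \<le> p"
  shows "u \<le> \<epsilon> + \<epsilon> powr (1 - p) * u powr p"
proof (cases "u \<le> \<epsilon>")
  case False
  then have "u = u powr (1 - p) * u powr p"
    using assms by (simp flip: powr_add)
  also have "\<dots> \<le> \<epsilon> powr (1 - p) * u powr p"
    using assms False by (intro mult_right_mono powr_mono2') auto
  finally show ?thesis using assms by simp
qed (simp add: add_increasing2)

lemma Lp_norm_ge_of_cs_extension_ge_1:
  assumes "0 < \<alpha>" "1 \<le> p"
  obtains c where "0 < c"
    "\<And>(f :: real^'n \<Rightarrow> real) x t. f \<in> Lp_space p \<Longrightarrow> (\<forall>x. 0 \<le> f x) \<Longrightarrow> 0 < t \<Longrightarrow>
      1 \<le> cs_extension \<alpha> f x t \<Longrightarrow> c * t ^ CARD('n) \<le> Lp_norm p f powr p"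
proof -
  obtain K where K: "0 < K"
    "\<And>t (x :: real^'n). 0 < t \<Longrightarrow> integrable lebesgue (\<lambda>y. cs_kernel \<alpha> t (x - y))"
    "\<And>t (x :: real^'n). 0 < t \<Longrightarrow> (LINT y|lebesgue. cs_kernel \<alpha> t (x - y)) \<le> K"
    using cs_kernel_mass_bounded[OF assms(1), where 'n='n] by blast
  let ?N = "real CARD('n)" and ?C = "cs_const TYPE('n) \<alpha>"
  \<comment> \<open>With this choice the term \<epsilon> contributes at most
    \<open>\<epsilon> * K = 1 / 2\<close> to the extension, so the term with |f|^p has to supply the
    other half.\<close>
  define \<epsilon> where "\<epsilon> = 1 / (2 * K)"
  define D where "D = \<epsilon> powr (1 - p) * ?C"
  have C: "0 < ?C" using assms cs_const_pos by blast
  have \<epsilon>: "0 < \<epsilon>" using K by (simp add: \<epsilon>_def)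
  have D: "0 < D" using C \<epsilon> by (simp add: D_def)
  show ?thesis
  proof
    show "0 < 1 / (2 * D)" using D by simp
    fix f :: "real^'n \<Rightarrow> real" and x t
    assume f: "f \<in> Lp_space p" "\<forall>x. 0 \<le> f x" and t: "0 < t" and ext: "1 \<le> cs_extension \<alpha> f x t"
    let ?k = "\<lambda>y. cs_kernel \<alpha> t (x - y)"
    let ?I = "LINT y|lebesgue. \<bar>f y\<bar> powr p"
    have int: "integrable lebesgue (\<lambda>y. \<bar>f y\<bar> powr p)" using f by (simp add: Lp_space_def)
    \<comment> \<open>A non-integrable integrand would make the extension 0, contrary to
      \<open>ext\<close>.\<close>
    have intkf: "integrable lebesgue (\<lambda>y. ?k y * f y)"
      using ext not_integrable_integral_eq by (force simp: cs_extension_def)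
    have "?k y * f y \<le> \<epsilon> * ?k y + D * t powr (- ?N) * \<bar>f y\<bar> powr p" for y
    proof -
      have "?k y * f y \<le> ?k y * (\<epsilon> + \<epsilon> powr (1 - p) * \<bar>f y\<bar> powr p)"
        using f le_add_powr[OF _ \<epsilon> assms(2), of "f y"] cs_kernel_nonneg[OF assms(1)]
        by (intro mult_left_mono) auto
      also have "\<dots> = \<epsilon> * ?k y + ?k y * (\<epsilon> powr (1 - p) * \<bar>f y\<bar> powr p)"
        by (simp add: algebra_simps)
      \<comment> \<open>The sup bound replaces the kernel only next to |f|^p; next to \<epsilon> the
        kernel is kept, since there its mass is used.\<close>
      also have "\<dots> \<le> \<epsilon> * ?k y + ?C * t powr (- ?N) * (\<epsilon> powr (1 - p) * \<bar>f y\<bar> powr p)"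
        using cs_kernel_le[OF assms(1) t] by (intro add_left_mono mult_right_mono) auto
      finally show ?thesis by (simp add: D_def ac_simps)
    qed
    then have "(LINT y|lebesgue. ?k y * f y) \<le>
        (LINT y|lebesgue. \<epsilon> * ?k y + D * t powr (- ?N) * \<bar>f y\<bar> powr p)"
      using K(2)[OF t] int intkf by (intro integral_mono) auto
    also have "\<dots> = \<epsilon> * (LINT y|lebesgue. ?k y) + D * t powr (- ?N) * ?I"
      using K(2)[OF t] int by simp
    also have "\<dots> \<le> \<epsilon> * K + D * t powr (- ?N) * ?I"
      using K(3)[OF t] \<epsilon> by simp
    also have "\<epsilon> * K = 1 / 2" using K by (simp add: \<epsilon>_def)
    finally have "1 / 2 \<le> D * t powr (- ?N) * ?I" using ext by (simp add: cs_extension_def)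
    also have "t powr (- ?N) = 1 / t ^ CARD('n)"
      using t by (simp add: powr_minus_divide powr_realpow)
    finally have "1 / (2 * D) * t ^ CARD('n) \<le> ?I"
      using t D by (simp add: field_simps)
    then show "1 / (2 * D) * t ^ CARD('n) \<le> Lp_norm p f powr p"
      using assms by (simp add: Lp_norm_powr)
  qed
qed

text \<open>Every admissible f satisfies the constraint at the midpoint, and this one point already
  forces the norm bound.\<close>

lemma Lp_capacity_cs_ball_ge:
  assumes "0 < \<alpha>" "1 \<le> p"
  obtains c where "0 < c"
    "\<And>(x0 :: real^'n) r0 t0. 0 < r0 \<Longrightarrow> 0 \<le> t0 \<Longrightarrow>
      ennreal (c * r0 ^ CARD('n)) \<le> Lp_capacity \<alpha> p (cs_ball r0 x0 t0)"
proof -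
  obtain c where c: "0 < c"
    "\<And>(f :: real^'n \<Rightarrow> real) x t. f \<in> Lp_space p \<Longrightarrow> (\<forall>x. 0 \<le> f x) \<Longrightarrow> 0 < t \<Longrightarrow>
      1 \<le> cs_extension \<alpha> f x t \<Longrightarrow> c * t ^ CARD('n) \<le> Lp_norm p f powr p"
    using Lp_norm_ge_of_cs_extension_ge_1[OF assms, where 'n='n] by blast
  show ?thesis
  proof
    show "0 < c" by fact
    fix x0 :: "real^'n" and r0 t0 :: real assume r: "0 < r0" "0 \<le> t0"
    \<comment> \<open>The middle of the interval from \<open>t0 + r0\<close> to
      \<open>t0 + 2 * r0\<close>; it is at least \<open>r0\<close> since \<open>t0\<close> is
      nonnegative.\<close>
    define t where "t = t0 + 3 / 2 * r0"
    have t: "0 < t" "r0 \<le> t" "(x0, t) \<in> cs_ball r0 x0 t0"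
      using r by (auto simp: t_def cs_ball_def upper_half_space_def)
    have "c * r0 ^ CARD('n) \<le> c * t ^ CARD('n)"
      using c r t by (intro mult_left_mono power_mono) auto
    then show "ennreal (c * r0 ^ CARD('n)) \<le> Lp_capacity \<alpha> p (cs_ball r0 x0 t0)"
      unfolding Lp_capacity_def using c(2)[OF _ _ t(1)] t(3)
      by (intro INF_greatest ennreal_leI) fastforce
  qed
qed

section \<open>Upper bound for the capacity\<close>

lemma Lp_norm_scaled_indicator_ball:
  fixes x :: "real^'n"
  assumes "0 < p" "0 \<le> \<mu>" "0 \<le> r"
  shows "(\<lambda>y. \<mu> * indicat_real (ball x r) y) \<in> Lp_space p"
    and "Lp_norm p (\<lambda>y. \<mu> * indicat_real (ball x r) y) powr p =
      \<mu> powr p * (unit_ball_vol CARD('n) * r ^ CARD('n))"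
proof -
  have eq: "\<bar>\<mu> * indicat_real (ball x r) y\<bar> powr p = \<mu> powr p * indicat_real (ball x r) y" for y
    using assms by (auto simp: indicator_def)
  have fin: "emeasure lebesgue (ball x r) = ennreal (unit_ball_vol CARD('n) * r ^ CARD('n))"
    using assms by (simp add: emeasure_ball)
  show "(\<lambda>y. \<mu> * indicat_real (ball x r) y) \<in> Lp_space p"
    using fin unfolding Lp_space_def mem_Collect_eq eq
    by (auto intro!: borel_measurable_times borel_measurable_indicator fmeasurableD[OF lmeasurable_ball])
  have "measure lebesgue (ball x r) = unit_ball_vol CARD('n) * r ^ CARD('n)"
    unfolding measure_def fin using assms by simp
  then show "Lp_norm p (\<lambda>y. \<mu> * indicat_real (ball x r) y) powr p =
      \<mu> powr p * (unit_ball_vol CARD('n) * r ^ CARD('n))"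
    unfolding Lp_norm_powr[OF assms(1)] eq by simp
qed

text \<open>For y in the ball, (x - y, t) has length at most 2 t, so the kernel is bounded below by
  a multiple of t^(-N). Integrating this over the ball brings in its volume, a multiple of
  r^N.\<close>

lemma cs_extension_scaled_indicator_ball_ge:
  fixes x0 :: "real^'n"
  assumes "0 < \<alpha>" "0 \<le> \<mu>" "0 < r" "r \<le> t" "norm (x - x0) < r / 2"
  shows "\<mu> * (cs_const TYPE('n) \<alpha> * 2 powr (- (real CARD('n) + \<alpha>)) *
      unit_ball_vol CARD('n) * (r / t) ^ CARD('n))
    \<le> cs_extension \<alpha> (\<lambda>y. \<mu> * indicat_real (ball x0 r) y) x t"
proof -
  let ?N = "real CARD('n)" and ?C = "cs_const TYPE('n) \<alpha>"
  let ?k = "\<lambda>y. cs_kernel \<alpha> t (x - y)"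
  have t: "0 < t" using assms by simp
  have K: "integrable lebesgue ?k"
    using cs_kernel_mass_bounded[OF assms(1), where 'n='n] t by metis
  have ind: "integrable lebesgue (indicat_real (ball x0 r))"
    using lmeasurable_ball[of x0 r] by (simp add: fmeasurable_def integrable_indicator_iff)
  have K_ind: "integrable lebesgue (\<lambda>y. ?k y * indicat_real (ball x0 r) y)"
    by (intro integrable_real_mult_indicator K fmeasurableD[OF lmeasurable_ball])
  have meas: "measure lebesgue (ball x0 r) = unit_ball_vol CARD('n) * r ^ CARD('n)"
    using assms by (simp add: measure_def emeasure_ball)
  \<comment> \<open>The lower bound of \<open>cs_kernel_ge_of_le\<close> for
    \<open>R = 2 * t\<close>.\<close>
  define m where "m = ?C * t powr \<alpha> * (2 * t) powr (- (?N + \<alpha>))"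
  have m: "m = ?C * 2 powr (- (?N + \<alpha>)) / t ^ CARD('n)"
  proof -
    have "m = ?C * 2 powr (- (?N + \<alpha>)) * (t powr \<alpha> * t powr (- (?N + \<alpha>)))"
      using t by (simp add: m_def powr_mult)
    also have "t powr \<alpha> * t powr (- (?N + \<alpha>)) = t powr (- ?N)"
      by (simp flip: powr_add)
    finally show ?thesis using t by (simp add: powr_minus_divide powr_realpow)
  qed
  have k: "m \<le> ?k y" if "y \<in> ball x0 r" for y
  proof -
    have "norm (x - y) \<le> norm (x - x0) + dist x0 y"
      using norm_triangle_ineq[of "x - x0" "x0 - y"] by (simp add: dist_norm)
    \<comment> \<open>The two distances are below r / 2 and r, and r \<le> t. The radius 2 t then
      suffices because 9/4 + 1 \<le> 4.\<close>
    then have "norm (x - y) \<le> 3 / 2 * t"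
      using that assms by simp
    then have "(norm (x - y))\<^sup>2 \<le> (3 / 2 * t)\<^sup>2" by (intro power_mono) auto
    then have "(norm (x - y))\<^sup>2 + t\<^sup>2 \<le> (3 / 2 * t)\<^sup>2 + t\<^sup>2"
      by simp
    also have "\<dots> \<le> (2 * t)\<^sup>2"
      by (simp add: power2_eq_square)
    finally show ?thesis unfolding m_def using assms t by (intro cs_kernel_ge_of_le) auto
  qed
  have "\<mu> * (m * measure lebesgue (ball x0 r)) =
      (LINT y|lebesgue. \<mu> * (m * indicat_real (ball x0 r) y))"
    by simp
  also have "\<dots> \<le> (LINT y|lebesgue. \<mu> * (?k y * indicat_real (ball x0 r) y))"
    using k assms
    by (intro integral_mono integrable_mult_right ind K_ind mult_left_mono)
      (auto simp: indicator_def)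
  also have "\<dots> = cs_extension \<alpha> (\<lambda>y. \<mu> * indicat_real (ball x0 r) y) x t"
    by (simp add: cs_extension_def ac_simps)
  finally show ?thesis
    using t by (simp add: m meas power_divide field_simps)
qed

lemma Lp_capacity_cs_ball_le:
  assumes "0 < \<alpha>" "1 \<le> p"
  obtains c where "0 < c"
    "\<And>(x0 :: real^'n) r0 t0. 0 < r0 \<Longrightarrow> 0 \<le> t0 \<Longrightarrow>
      Lp_capacity \<alpha> p (cs_ball r0 x0 t0) \<le>
        ennreal (c * (t0 + r0) powr (p * real CARD('n)) * r0 powr (real CARD('n) * (1 - p)))"
proof -
  let ?N = "real CARD('n)" and ?V = "unit_ball_vol CARD('n)"
  \<comment> \<open>\<open>b\<close> is the constant in the lower bound for the extension of an
    indicator. The 2^N in \<open>d\<close> pays for t \<le> 2 (t0 + r0) on the set.\<close>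
  define b where "b = cs_const TYPE('n) \<alpha> * 2 powr (- (?N + \<alpha>)) * ?V"
  define d where "d = 2 ^ CARD('n) / b"
  have b: "0 < b" unfolding b_def using cs_const_pos[OF assms(1), where 'n='n] by simp
  have d: "0 < d" using b by (simp add: d_def)
  show ?thesis
  proof
    show "0 < d powr p * ?V" using d by simp
    fix x0 :: "real^'n" and r0 t0 :: real assume r: "0 < r0" "0 \<le> t0"
    \<comment> \<open>The height for which the lower bound for the extension equals 1 when t is
      replaced by its upper bound 2 (t0 + r0).\<close>
    define \<mu> where "\<mu> = d * ((t0 + r0) / r0) ^ CARD('n)"
    define f where "f = (\<lambda>y. \<mu> * indicat_real (ball x0 r0) y)"
    have \<mu>: "0 < \<mu>" using r d by (simp add: \<mu>_def)
    have "1 \<le> cs_extension \<alpha> f x t" if "(x, t) \<in> cs_ball r0 x0 t0" for x t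
    proof -
      have t: "r0 \<le> t" "t \<le> 2 * (t0 + r0)" and x: "norm (x - x0) < r0 / 2"
        using that r by (auto simp: cs_ball_def)
      have "1 = \<mu> * (b * (r0 / (2 * (t0 + r0))) ^ CARD('n))"
        using b r
        by (simp add: \<mu>_def d_def power_divide power_mult_distrib del: distrib_left_numeral)
      also have "\<dots> \<le> \<mu> * (b * (r0 / t) ^ CARD('n))"
        using \<mu> b r t by (intro mult_left_mono power_mono divide_left_mono) auto
      also have "\<dots> \<le> cs_extension \<alpha> f x t"
        using cs_extension_scaled_indicator_ball_ge[OF assms(1) less_imp_le[OF \<mu>] r(1) t(1) x]
        by (simp add: f_def b_def)
      finally show ?thesis .
    qed
    then have "Lp_capacity \<alpha> p (cs_ball r0 x0 t0) \<le> ennreal (Lp_norm p f powr p)"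
      unfolding Lp_capacity_def using Lp_norm_scaled_indicator_ball(1)[of p \<mu> r0 x0] \<mu> r assms
      by (intro INF_lower) (auto simp: f_def)
    also have "Lp_norm p f powr p = \<mu> powr p * (?V * r0 ^ CARD('n))"
      unfolding f_def using \<mu> r assms by (intro Lp_norm_scaled_indicator_ball(2)) auto
    also have "\<mu> powr p = d powr p * ((t0 + r0) powr (p * ?N) * r0 powr (- (p * ?N)))"
      using d r unfolding \<mu>_def
      by (simp add: powr_mult powr_divide powr_powr powr_minus_divide mult.commute flip: powr_realpow)
    \<comment> \<open>The volume of the ball contributes r0^N, which combines with the r0^(-pN) from
      the height to r0^(N(1-p)).\<close>
    also have "d powr p * ((t0 + r0) powr (p * ?N) * r0 powr (- (p * ?N))) * (?V * r0 ^ CARD('n)) =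
        d powr p * ?V * (t0 + r0) powr (p * ?N) * (r0 powr (- (p * ?N)) * r0 powr ?N)"
      using r by (simp add: powr_realpow)
    also have "r0 powr (- (p * ?N)) * r0 powr ?N = r0 powr (?N * (1 - p))"
      by (simp add: algebra_simps flip: powr_add)
    finally show "Lp_capacity \<alpha> p (cs_ball r0 x0 t0) \<le>
        ennreal (d powr p * ?V * (t0 + r0) powr (p * ?N) * r0 powr (?N * (1 - p)))" .
  qed
qed

section \<open>Both bounds together, and the case of t0 comparable to r0\<close>

theorem theorem2p10:
  fixes \<alpha> p :: real
  assumes "0 < \<alpha>" and "\<alpha> < 2" and "1 \<le> p"
  shows "(\<exists>c1 > 0. \<exists>c2 > 0. \<forall>(x0 :: real^'n) (r0 :: real) (t0 :: real).
            (x0, r0) \<in> upper_half_space \<longrightarrow> 0 \<le> t0 \<longrightarrow>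
              ennreal (c1 * r0 ^ CARD('n)) \<le> Lp_capacity \<alpha> p (cs_ball r0 x0 t0) \<and>
              Lp_capacity \<alpha> p (cs_ball r0 x0 t0) \<le>
                ennreal (c2 * (t0 + r0) powr (p * real CARD('n)) *
                         r0 powr (real CARD('n) * (1 - p)))) \<and>
         (\<forall>c > 0. \<exists>c1 > 0. \<exists>c2 > 0. \<forall>(x0 :: real^'n) (r0 :: real) (t0 :: real).
            (x0, r0) \<in> upper_half_space \<longrightarrow> 0 \<le> t0 \<longrightarrow> t0 \<le> c * r0 \<longrightarrow>
              ennreal (c1 * r0 ^ CARD('n)) \<le> Lp_capacity \<alpha> p (cs_ball r0 x0 t0) \<and>
              Lp_capacity \<alpha> p (cs_ball r0 x0 t0) \<le> ennreal (c2 * r0 ^ CARD('n)))"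
proof -
  let ?N = "real CARD('n)"
  obtain c1 where c1: "0 < c1"
    "\<And>(x0 :: real^'n) r0 t0. 0 < r0 \<Longrightarrow> 0 \<le> t0 \<Longrightarrow>
      ennreal (c1 * r0 ^ CARD('n)) \<le> Lp_capacity \<alpha> p (cs_ball r0 x0 t0)"
    using Lp_capacity_cs_ball_ge[OF assms(1,3), where 'n='n] by blast
  obtain c2 where c2: "0 < c2"
    "\<And>(x0 :: real^'n) r0 t0. 0 < r0 \<Longrightarrow> 0 \<le> t0 \<Longrightarrow>
      Lp_capacity \<alpha> p (cs_ball r0 x0 t0) \<le>
        ennreal (c2 * (t0 + r0) powr (p * ?N) * r0 powr (?N * (1 - p)))"
    using Lp_capacity_cs_ball_le[OF assms(1,3), where 'n='n] by blast
  \<comment> \<open>Since t0 + r0 \<le> (1 + c) r0, the upper bound becomes a pure power of r0, and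
    the exponents p N and N (1 - p) add up to N.\<close>
  have le: "Lp_capacity \<alpha> p (cs_ball r0 x0 t0) \<le>
      ennreal (c2 * (1 + c) powr (p * ?N) * r0 ^ CARD('n))"
    if "0 < c" "0 < r0" "0 \<le> t0" "t0 \<le> c * r0" for c r0 t0 and x0 :: "real^'n"
  proof -
    have "(t0 + r0) powr (p * ?N) \<le> ((1 + c) * r0) powr (p * ?N)"
      using that assms by (intro powr_mono2) (auto simp: algebra_simps)
    also have "\<dots> = (1 + c) powr (p * ?N) * r0 powr (p * ?N)"
      using that by (simp add: powr_mult)
    finally have "c2 * (t0 + r0) powr (p * ?N) * r0 powr (?N * (1 - p)) \<le>
        c2 * ((1 + c) powr (p * ?N) * r0 powr (p * ?N)) * r0 powr (?N * (1 - p))"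
      using c2(1) by (intro mult_right_mono mult_left_mono) auto
    also have "\<dots> = c2 * (1 + c) powr (p * ?N) * (r0 powr (p * ?N) * r0 powr (?N * (1 - p)))"
      by simp
    also have "r0 powr (p * ?N) * r0 powr (?N * (1 - p)) = r0 ^ CARD('n)"
      using that by (simp add: algebra_simps flip: powr_add powr_realpow)
    finally show ?thesis
      using c2(2)[OF that(2,3), of x0] by (meson ennreal_leI order_trans)
  qed
  have "\<exists>c1>0. \<exists>c2>0. \<forall>(x0 :: real^'n) r0 t0.
      (x0, r0) \<in> upper_half_space \<longrightarrow> 0 \<le> t0 \<longrightarrow> t0 \<le> c * r0 \<longrightarrow>
        ennreal (c1 * r0 ^ CARD('n)) \<le> Lp_capacity \<alpha> p (cs_ball r0 x0 t0) \<and>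
        Lp_capacity \<alpha> p (cs_ball r0 x0 t0) \<le> ennreal (c2 * r0 ^ CARD('n))"
    \<comment> \<open>The lower constant is the same for every c; only the upper one depends on
      c.\<close>
    if "0 < c" for c
    using c1 c2(1) le[OF that] that
    by (intro exI[of _ c1] exI[of _ "c2 * (1 + c) powr (p * ?N)"] conjI)
      (auto simp: upper_half_space_def)
  with c1 c2 show ?thesis
    by (intro conjI exI[of _ c1] exI[of _ c2]) (auto simp: upper_half_space_def)
qed

end
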